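(* Let $\alpha>0$, $\mu,h,\beta\in\mathbb{R}$, $|c|<1$, and consider coherent structure solutions with speed $s$ and superimposed frequency $\Omega$, i.e. solutions $(\theta,p,q)(\xi)$ of $$\theta'=p,\qquad p'=\sin\theta\,\big(h+(q^2-\mu)\cos\theta-(\Omega-sq)\big)-\alpha s p,\qquad q'=\alpha(\Omega-sq)-\frac{\beta}{1+c\cos\theta}-\frac{s+2\cos(\theta)q}{\sin\theta}\,p .$$ Non-equilibrium coherent structure solutions with $q\equiv0$ for $s\neq0$ exist for $\mu<0$ and ($c=0$ or $\beta=0$) only, and have $$\Omega=\frac{h+\alpha\beta}{1+\alpha^2},\qquad s^2=-\frac{(\beta-\alpha h)^2}{\mu(1+\alpha^2)^2}.$$ They are oscillating heteroclinic fronts connecting $\pm\boldsymbol{\hat e}_3$ that solve $\theta'=\sigma\sqrt{-\mu}\,\sin\theta$, where $\sigma=\mathrm{sgn}(s(\alpha h-\beta))$. The family of such fronts is smooth and extends to $s=0$, where $h=\Omega=\beta/\alpha$, and there fronts exist for both signs of $\sigma$.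
   Context: The underlying equation is, for $\boldsymbol m(x,t)\in\mathbb{S}^2$, $x\in\mathbb{R}$, $$\partial_t\boldsymbol m=\boldsymbol m\times\Big[\alpha\partial_t\boldsymbol m-\partial_x^2\boldsymbol m+(\mu m_3-h)\boldsymbol{\hat e}_3+\frac{\beta}{1+c\,m_3}\,\boldsymbol m\times\boldsymbol{\hat e}_3\Big].$$ Writing $\boldsymbol m=(e^{i\varphi}\sin\theta,\cos\theta)$ (the $(m_1,m_2)$-plane identified with $\mathbb{C}$), coherent structures are solutions of the form $\xi=x-st$, $\varphi=\phi(\xi)+\Omega t$, $\theta=\theta(\xi)$ with constants $s,\Omega\in\mathbb{R}$; the displayed ODE system arises with $q=\phi'$ and $'=d/d\xi$. Here $q\equiv0$ means there is no spatially varying azimuthal profile. The states $\pm\boldsymbol{\hat e}_3$ correspond to $\theta=0,\pi$. *)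

theory Defs
  imports "HOL-Analysis.Analysis"
begin

fun Ck_on :: "nat \<Rightarrow> 'a::euclidean_space set \<Rightarrow> ('a \<Rightarrow> 'b::real_normed_vector) \<Rightarrow> bool" where
  "Ck_on 0 S f \<longleftrightarrow> continuous_on S f"
| "Ck_on (Suc k) S f \<longleftrightarrow>
     (\<forall>x\<in>S. f differentiable (at x)) \<and>
     (\<forall>v. Ck_on k S (\<lambda>x. frechet_derivative f (at x) v))"

text \<open>Only meaningful for open \<open>S\<close>, since derivatives are taken at full neighbourhoods.\<close>
definition smooth_on :: "'a::euclidean_space set \<Rightarrow> ('a \<Rightarrow> 'b::real_normed_vector) \<Rightarrow> bool" where
  "smooth_on S f \<longleftrightarrow> (\<forall>k. Ck_on k S f)"

text \<open>The vector field is singular where \<open>sin \<theta> = 0\<close>, so this is excluded explicitly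
  (division by zero would otherwise silently yield zero).\<close>
definition coherent_structure ::
  "real \<Rightarrow> real \<Rightarrow> real \<Rightarrow> real \<Rightarrow> real \<Rightarrow> real \<Rightarrow> real \<Rightarrow>
   (real \<Rightarrow> real) \<Rightarrow> (real \<Rightarrow> real) \<Rightarrow> (real \<Rightarrow> real) \<Rightarrow> bool" where
  "coherent_structure \<alpha> \<mu> h \<beta> c s \<Omega> \<theta> p q \<longleftrightarrow>
    (\<forall>\<xi>. sin (\<theta> \<xi>) \<noteq> 0 \<and>
      (\<theta> has_real_derivative p \<xi>) (at \<xi>) \<and>
      (p has_real_derivative
        sin (\<theta> \<xi>) * (h + ((q \<xi>)\<^sup>2 - \<mu>) * cos (\<theta> \<xi>) - (\<Omega> - s * q \<xi>)) - \<alpha> * s * p \<xi>) (at \<xi>) \<and>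
      (q has_real_derivative
        \<alpha> * (\<Omega> - s * q \<xi>) - \<beta> / (1 + c * cos (\<theta> \<xi>))
          - (s + 2 * cos (\<theta> \<xi>) * q \<xi>) / sin (\<theta> \<xi>) * p \<xi>) (at \<xi>))"

definition equilibrium :: "(real \<Rightarrow> real) \<Rightarrow> (real \<Rightarrow> real) \<Rightarrow> (real \<Rightarrow> real) \<Rightarrow> bool" where
  "equilibrium \<theta> p q \<longleftrightarrow> (\<exists>a b d. \<forall>\<xi>. \<theta> \<xi> = a \<and> p \<xi> = b \<and> q \<xi> = d)"

definition homogeneous_coherent_structure ::
  "real \<Rightarrow> real \<Rightarrow> real \<Rightarrow> real \<Rightarrow> real \<Rightarrow> real \<Rightarrow> real \<Rightarrow>
   (real \<Rightarrow> real) \<Rightarrow> (real \<Rightarrow> real) \<Rightarrow> (real \<Rightarrow> real) \<Rightarrow> bool" where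
  "homogeneous_coherent_structure \<alpha> \<mu> h \<beta> c s \<Omega> \<theta> p q \<longleftrightarrow>
    coherent_structure \<alpha> \<mu> h \<beta> c s \<Omega> \<theta> p q \<and> \<not> equilibrium \<theta> p q \<and> (\<forall>\<xi>. q \<xi> = 0)"

text \<open>Points of the sphere are pairs \<open>(m\<^sub>1 + \<i> m\<^sub>2, m\<^sub>3)\<close>.\<close>
definition magnetization ::
  "real \<Rightarrow> real \<Rightarrow> (real \<Rightarrow> real) \<Rightarrow> (real \<Rightarrow> real) \<Rightarrow> real \<Rightarrow> real \<Rightarrow> complex \<times> real" where
  "magnetization s \<Omega> \<phi> \<theta> x t =
    (cis (\<phi> (x - s * t) + \<Omega> * t) * of_real (sin (\<theta> (x - s * t))), cos (\<theta> (x - s * t)))"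

text \<open>\<open>(0, 1)\<close> and \<open>(0, -1)\<close> are the states \<open>e\<^sub>3\<close> and \<open>-e\<^sub>3\<close>;
  either one may be the state at \<open>x = -\<infinity>\<close>.\<close>
definition heteroclinic_front :: "(real \<Rightarrow> real \<Rightarrow> complex \<times> real) \<Rightarrow> bool" where
  "heteroclinic_front m \<longleftrightarrow>
    (\<exists>\<tau>\<in>{-1, 1}. \<forall>t. ((\<lambda>x. m x t) \<longlongrightarrow> (0, \<tau>)) at_bot \<and> ((\<lambda>x. m x t) \<longlongrightarrow> (0, - \<tau>)) at_top)"

text \<open>In the frame moving with speed \<open>s\<close> the whole profile rotates rigidly about the
  \<open>e\<^sub>3\<close>-axis with frequency \<open>\<Omega>\<close>.\<close>
definition oscillating :: "real \<Rightarrow> real \<Rightarrow> (real \<Rightarrow> real \<Rightarrow> complex \<times> real) \<Rightarrow> bool" where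
  "oscillating s \<Omega> m \<longleftrightarrow>
    (\<forall>x t r. m (x + s * r) (t + r) = (cis (\<Omega> * r) * fst (m x t), snd (m x t)))"

definition oscillating_front ::
  "real \<Rightarrow> real \<Rightarrow> real \<Rightarrow> real \<Rightarrow> (real \<Rightarrow> real) \<Rightarrow> (real \<Rightarrow> real) \<Rightarrow> bool" where
  "oscillating_front \<mu> s \<Omega> \<sigma> \<theta> q \<longleftrightarrow>
    (\<forall>\<xi>. (\<theta> has_real_derivative \<sigma> * sqrt (- \<mu>) * sin (\<theta> \<xi>)) (at \<xi>)) \<and>
    (\<forall>\<phi>. (\<forall>\<xi>. (\<phi> has_real_derivative q \<xi>) (at \<xi>)) \<longrightarrow>
       heteroclinic_front (magnetization s \<Omega> \<phi> \<theta>) \<and>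
       oscillating s \<Omega> (magnetization s \<Omega> \<phi> \<theta>))"

end

theory Submission
  imports Defs
begin

text \<open>
  If \<open>q\<close> vanishes identically, the equation for \<open>q'\<close> degenerates to the algebraic constraint
  \<open>s p = sin \<theta> (\<alpha> \<Omega> - \<beta> / (1 + c cos \<theta>))\<close>, and the system for \<open>(\<theta>, p)\<close> is overdetermined. For \<open>s \<noteq> 0\<close> the
  constraint determines \<open>p\<close>; its compatibility with the equation for \<open>p'\<close> is a rational identity in
  \<open>u = cos \<theta>\<close>, valid on the infinite range of a nonconstant profile and therefore everywhere.
  Evaluating it at the pole \<open>u = -1/c\<close> forces \<open>c = 0\<close> or \<open>\<beta> = 0\<close>
  (\<open>moving_homogeneous_imp_beta_or_c_zero\<close>). The constraint then reads \<open>\<theta>' = \<kappa> sin \<theta>\<close> with a constant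
  \<open>\<kappa> \<noteq> 0\<close>, the equation of a domain wall.

  Conversely, given a wall profile of slope \<open>\<kappa>\<close>, for any \<open>s\<close>, comparing coefficients in \<open>u\<close> turns the
  structure equations into \<open>\<alpha> \<Omega> = \<beta> + s \<kappa>\<close>, \<open>h = \<Omega> + \<alpha> s \<kappa>\<close>, \<open>\<kappa>\<^sup>2 = - \<mu>\<close> together with \<open>c = 0\<close> or \<open>\<beta> = 0\<close>
  (\<open>wall_profile_homogeneous_iff\<close>). Everything else is a reading of these relations. Eliminating \<open>\<kappa>\<close>
  gives the formulas for \<open>\<Omega>\<close> and \<open>s\<^sup>2\<close>, and multiplying out gives the sign of \<open>\<kappa>\<close>. Solving them for
  \<open>(h, \<Omega>)\<close> with \<open>\<kappa> = \<sigma> sqrt (- \<mu>)\<close> gives functions that are smooth in \<open>(\<alpha>, \<mu>, \<beta>, s)\<close> across \<open>s = 0\<close>, where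
  both signs of \<open>\<sigma>\<close> occur with \<open>h = \<Omega> = \<beta> / \<alpha>\<close>.

  The wall equation is solved explicitly: up to translation of \<open>\<xi>\<close>, reflection and shifts of \<open>\<theta>\<close> by
  multiples of \<open>2\<pi>\<close>, its only solution with nonvanishing sine is \<open>2 arctan (exp (\<kappa> \<xi>))\<close>
  (\<open>wall_profile_iff_kink\<close>). This shows the limits at the two poles, and gives the smooth dependence of
  the profile on the parameters.
\<close>

section \<open>Closure properties of smooth functions\<close>

lemma Ck_on_cong:
  assumes "open S" "Ck_on k S f" "\<And>x. x \<in> S \<Longrightarrow> f x = g x"
  shows "Ck_on k S g"
  using assms(2,3)
proof (induction k arbitrary: f g)
  case 0
  then show ?case by (simp cong: continuous_on_cong)
next
  case (Suc k)
  have D: "(g has_derivative frechet_derivative f (at x)) (at x)" if "x \<in> S" for x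
  proof (rule has_derivative_transform_within_open)
    show "(f has_derivative frechet_derivative f (at x)) (at x)"
      using Suc.prems(1) that frechet_derivative_works by auto
  qed (use that assms(1) Suc.prems(2) in auto)
  show ?case
    unfolding Ck_on.simps
  proof (intro conjI ballI allI)
    fix x assume "x \<in> S"
    then show "g differentiable (at x)" using D differentiable_def by blast
  next
    fix v
    show "Ck_on k S (\<lambda>x. frechet_derivative g (at x) v)"
    proof (rule Suc.IH)
      show "Ck_on k S (\<lambda>x. frechet_derivative f (at x) v)" using Suc.prems(1) by simp
      show "frechet_derivative f (at x) v = frechet_derivative g (at x) v" if "x \<in> S" for x
        using frechet_derivative_at[OF D[OF that]] by simp
    qed
  qed
qed

text \<open>The predicate \<open>Ck_on\<close> refers to the Frechet derivative chosen by a description operator; this rule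
  allows any explicitly computed derivative to be used instead.\<close>

lemma Ck_on_SucI:
  assumes "open S" "\<And>x. x \<in> S \<Longrightarrow> (f has_derivative f' x) (at x)"
    "\<And>v. Ck_on k S (\<lambda>x. f' x v)"
  shows "Ck_on (Suc k) S f"
  unfolding Ck_on.simps
proof (intro conjI ballI allI)
  fix x assume "x \<in> S"
  then show "f differentiable (at x)" using assms(2) differentiable_def by blast
next
  fix v
  show "Ck_on k S (\<lambda>x. frechet_derivative f (at x) v)"
    by (rule Ck_on_cong[OF assms(1) assms(3)[of v]])
      (use frechet_derivative_at[OF assms(2)] in simp)
qed

lemma Ck_on_Suc_has_derivative:
  assumes "Ck_on (Suc k) S f" "x \<in> S"
  shows "(f has_derivative frechet_derivative f (at x)) (at x)"
  using assms frechet_derivative_works by auto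

lemma Ck_on_Suc_D: "Ck_on (Suc k) S f \<Longrightarrow> Ck_on k S f"
proof (induction k arbitrary: f)
  case 0
  then have "continuous (at x) f" if "x \<in> S" for x
    using that differentiable_imp_continuous_within by auto
  then show ?case
    by (auto intro: continuous_at_imp_continuous_on)
next
  case (Suc k)
  have "Ck_on k S (\<lambda>x. frechet_derivative f (at x) v)" for v
    using Suc.prems by (intro Suc.IH) (metis Ck_on.simps(2))
  moreover have "f differentiable (at x)" if "x \<in> S" for x
    using Suc.prems that by (metis Ck_on.simps(2))
  ultimately show ?case
    by (metis Ck_on.simps(2))
qed

lemma Ck_on_const: "open S \<Longrightarrow> Ck_on k S (\<lambda>x. a)"
  by (induction k arbitrary: a) (auto simp: frechet_derivative_const)

lemma Ck_on_linear:
  assumes "open S" "bounded_linear f"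
  shows "Ck_on k S f"
proof (cases k)
  case 0
  then show ?thesis
    using assms linear_continuous_on by auto
next
  case (Suc l)
  show ?thesis
    unfolding Suc
    by (rule Ck_on_SucI[OF assms(1), where f' = "\<lambda>x. f"])
      (use assms bounded_linear_imp_has_derivative Ck_on_const in auto)
qed

lemma Ck_on_add:
  assumes "open S"
  shows "Ck_on k S f \<Longrightarrow> Ck_on k S g \<Longrightarrow> Ck_on k S (\<lambda>x. f x + g x)"
proof (induction k arbitrary: f g)
  case 0
  then show ?case by (simp add: continuous_on_add)
next
  case (Suc k)
  show ?case
  proof (rule Ck_on_SucI[OF assms])
    show "((\<lambda>x. f x + g x) has_derivative
        (\<lambda>v. frechet_derivative f (at x) v + frechet_derivative g (at x) v)) (at x)"
      if "x \<in> S" for x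
      using that Suc.prems by (intro has_derivative_add Ck_on_Suc_has_derivative)
    show "Ck_on k S (\<lambda>x. frechet_derivative f (at x) v + frechet_derivative g (at x) v)" for v
      using Suc by simp
  qed
qed

lemma Ck_on_mult:
  fixes f g :: "'a::euclidean_space \<Rightarrow> 'b::real_normed_algebra"
  assumes "open S"
  shows "Ck_on k S f \<Longrightarrow> Ck_on k S g \<Longrightarrow> Ck_on k S (\<lambda>x. f x * g x)"
proof (induction k arbitrary: f g)
  case 0
  then show ?case by (simp add: continuous_on_mult)
next
  case (Suc k)
  show ?case
  proof (rule Ck_on_SucI[OF assms])
    show "((\<lambda>x. f x * g x) has_derivative
        (\<lambda>v. f x * frechet_derivative g (at x) v + frechet_derivative f (at x) v * g x)) (at x)"
      if "x \<in> S" for x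
      using that Suc.prems by (intro has_derivative_mult Ck_on_Suc_has_derivative)
    show "Ck_on k S (\<lambda>x. f x * frechet_derivative g (at x) v
        + frechet_derivative f (at x) v * g x)" for v
      using Suc.prems Suc.prems[THEN Ck_on_Suc_D]
      by (intro Ck_on_add[OF assms] Suc.IH) auto
  qed
qed

text \<open>The induction generalises over the outer function only: the derivative of \<open>g \<circ> f\<close> in direction \<open>v\<close>
  is the product of \<open>g' \<circ> f\<close>, which the induction hypothesis covers, and the directional
  derivative of \<open>f\<close>.\<close>

lemma Ck_on_compose_real:
  fixes g :: "real \<Rightarrow> real" and f :: "'a::euclidean_space \<Rightarrow> real"
  assumes "open S" "open T" "f ` S \<subseteq> T"
  shows "Ck_on k T g \<Longrightarrow> Ck_on k S f \<Longrightarrow> Ck_on k S (\<lambda>x. g (f x))"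
proof (induction k arbitrary: g)
  case 0
  then show ?case using assms(3) by (auto intro: continuous_on_compose2)
next
  case (Suc k)
  let ?g' = "\<lambda>y. frechet_derivative g (at y) 1"
  show ?case
  proof (rule Ck_on_SucI[OF assms(1)])
    show "((\<lambda>x. g (f x)) has_derivative
        (\<lambda>v. frechet_derivative f (at x) v * ?g' (f x))) (at x)"
      if "x \<in> S" for x
    proof -
      have f: "(f has_derivative frechet_derivative f (at x)) (at x)"
        using that Suc.prems(2) by (rule Ck_on_Suc_has_derivative[rotated])
      have g: "(g has_derivative frechet_derivative g (at (f x))) (at (f x))"
        by (rule Ck_on_Suc_has_derivative[OF Suc.prems(1)]) (use that assms(3) in auto)
      have "frechet_derivative g (at (f x)) w = w * ?g' (f x)" for w
        using linear_cmul[OF has_derivative_linear[OF g], of w 1] by simp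
      then have "(\<lambda>v. frechet_derivative g (at (f x)) (frechet_derivative f (at x) v))
          = (\<lambda>v. frechet_derivative f (at x) v * ?g' (f x))"
        by (rule ext)
      then show ?thesis
        using has_derivative_compose[OF f g] by metis
    qed
    show "Ck_on k S (\<lambda>x. frechet_derivative f (at x) v * ?g' (f x))" for v
    proof (rule Ck_on_mult[OF assms(1)])
      show "Ck_on k S (\<lambda>x. frechet_derivative f (at x) v)"
        using Suc.prems(2) by simp
      show "Ck_on k S (\<lambda>x. ?g' (f x))"
        by (rule Suc.IH[OF _ Ck_on_Suc_D[OF Suc.prems(2)]]) (use Suc.prems(1) in simp)
    qed
  qed
qed

lemma smooth_on_const: "open S \<Longrightarrow> smooth_on S (\<lambda>x. a)"
  by (simp add: smooth_on_def Ck_on_const)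

lemma smooth_on_linear: "open S \<Longrightarrow> bounded_linear f \<Longrightarrow> smooth_on S f"
  by (simp add: smooth_on_def Ck_on_linear)

lemma smooth_on_add:
  "open S \<Longrightarrow> smooth_on S f \<Longrightarrow> smooth_on S g \<Longrightarrow> smooth_on S (\<lambda>x. f x + g x)"
  by (simp add: smooth_on_def Ck_on_add)

lemma smooth_on_mult:
  fixes f g :: "'a::euclidean_space \<Rightarrow> 'b::real_normed_algebra"
  shows "open S \<Longrightarrow> smooth_on S f \<Longrightarrow> smooth_on S g \<Longrightarrow> smooth_on S (\<lambda>x. f x * g x)"
  by (simp add: smooth_on_def Ck_on_mult)

lemma smooth_on_compose_real:
  fixes g :: "real \<Rightarrow> real" and f :: "'a::euclidean_space \<Rightarrow> real"
  assumes "open S" "open T" "f ` S \<subseteq> T" "smooth_on T g" "smooth_on S f"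
  shows "smooth_on S (\<lambda>x. g (f x))"
  using assms by (simp add: smooth_on_def Ck_on_compose_real)

lemma Ck_on_Suc_real:
  fixes f :: "real \<Rightarrow> real"
  assumes "open T" "\<And>x. x \<in> T \<Longrightarrow> (f has_real_derivative f' x) (at x)" "Ck_on k T f'"
  shows "Ck_on (Suc k) T f"
  by (rule Ck_on_SucI[OF assms(1), where f' = "\<lambda>x v. f' x * v"])
    (use assms in \<open>auto simp: has_field_derivative_def intro!: Ck_on_mult Ck_on_const\<close>)

text \<open>Bootstrapping: if \<open>y\<close> is \<open>C\<^sup>k\<close>, then so is \<open>y' = F \<circ> y\<close>, hence \<open>y\<close> is \<open>C\<^sup>k\<^sup>+\<^sup>1\<close>. This disposes of the
  inverse, the square root and the domain-wall profile at once, without any formula for their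
  higher derivatives.\<close>

lemma smooth_on_autonomous_ode:
  fixes y F :: "real \<Rightarrow> real"
  assumes "open T" "open V" "y ` T \<subseteq> V" "smooth_on V F"
    and ode: "\<And>x. x \<in> T \<Longrightarrow> (y has_real_derivative F (y x)) (at x)"
  shows "smooth_on T y"
  unfolding smooth_on_def
proof
  fix k
  show "Ck_on k T y"
  proof (induction k)
    case 0
    show ?case
      using DERIV_isCont[OF ode] by (simp add: continuous_at_imp_continuous_on)
  next
    case (Suc k)
    have "Ck_on k T (\<lambda>x. F (y x))"
      using Ck_on_compose_real[OF assms(1-3) _ Suc] assms(4) by (simp add: smooth_on_def)
    then show ?case
      using Ck_on_Suc_real[OF assms(1) ode] by blast
  qed
qed

lemma smooth_on_inverse: "smooth_on {y::real. y \<noteq> 0} inverse"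
proof (rule smooth_on_autonomous_ode)
  show "smooth_on UNIV (\<lambda>y::real. (- 1) * (y * y))"
    by (intro smooth_on_mult smooth_on_const smooth_on_linear bounded_linear_ident open_UNIV)
  show "(inverse has_real_derivative (- 1) * (inverse x * inverse x)) (at x)"
    if "x \<in> {y. y \<noteq> 0}" for x :: real
    using that by (auto intro!: derivative_eq_intros)
qed (auto intro: open_Collect_neq continuous_intros)

lemma smooth_on_sqrt: "smooth_on {y::real. y > 0} sqrt"
proof (rule smooth_on_autonomous_ode)
  show op: "open {y::real. y > 0}" "open {y::real. y \<noteq> 0}" 
    by (auto intro!: open_Collect_less open_Collect_neq continuous_intros)
  show "sqrt ` {y. y > 0} \<subseteq> {y. y \<noteq> 0}" by auto
  show "smooth_on {y. y \<noteq> 0} (\<lambda>y::real. (1/2) * inverse y)"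
    by (intro smooth_on_mult smooth_on_const smooth_on_inverse op)
  show "(sqrt has_real_derivative (1/2) * inverse (sqrt x)) (at x)"
    if "x \<in> {y. y > 0}" for x
    using that by (auto intro!: derivative_eq_intros simp: field_simps)
qed

lemma smooth_on_sin: "smooth_on UNIV (sin :: real \<Rightarrow> real)"
proof -
  have "Ck_on k UNIV (sin :: real \<Rightarrow> real) \<and> Ck_on k UNIV (cos :: real \<Rightarrow> real)" for k
  proof (induction k)
    case 0
    show ?case by (auto intro: continuous_intros)
  next
    case (Suc k)
    have "Ck_on k UNIV (\<lambda>x::real. (- 1) * sin x)"
      using Suc by (intro Ck_on_mult Ck_on_const open_UNIV) auto
    then show ?case
      using Suc by (auto intro!: Ck_on_Suc_real[where f = sin and f' = cos]
          Ck_on_Suc_real[where f = cos and f' = "\<lambda>x. (- 1) * sin x"] derivative_eq_intros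
          simp del: Ck_on.simps)
  qed
  then show ?thesis by (simp add: smooth_on_def)
qed

section \<open>Domain-wall profiles\<close>

text \<open>The solution of \<open>\<theta>' = sin \<theta>\<close> with values in \<open>(0, \<pi>)\<close> and \<open>\<theta>(0) = \<pi>/2\<close>; \<open>kink z - \<pi>/2\<close> is the
  Gudermannian function.\<close>

definition kink :: "real \<Rightarrow> real" where
  "kink z = 2 * arctan (exp z)"

lemma kink_bounds: "0 < kink z" "kink z < pi"
  using arctan_ubound[of "exp z"] by (auto simp: kink_def)

lemma kink_has_derivative: "(kink has_real_derivative sin (kink z)) (at z)"
proof -
  have "sin (kink z) = 2 * exp z / (1 + (exp z)\<^sup>2)"
    by (simp add: kink_def sin_double sin_arctan cos_arctan add_pos_pos)
  moreover have "(kink has_real_derivative 2 * exp z / (1 + (exp z)\<^sup>2)) (at z)"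
    unfolding kink_def [abs_def]
    by (auto intro!: derivative_eq_intros simp: field_simps)
  ultimately show ?thesis by simp
qed

lemma kink_tendsto_at_bot: "(kink \<longlongrightarrow> 0) at_bot"
  unfolding kink_def [abs_def]
  using tendsto_mult[OF tendsto_const tendsto_arctan[OF exp_at_bot], of 2] by simp

lemma kink_tendsto_at_top: "(kink \<longlongrightarrow> pi) at_top"
  unfolding kink_def [abs_def]
  using tendsto_mult[OF tendsto_const filterlim_compose[OF tendsto_arctan_at_top exp_at_top], of 2]
  by simp

text \<open>The condition on the sine excludes the rest points \<open>\<theta> \<in> \<pi>\<int>\<close>, at which the structure equations are
  singular.\<close>

definition wall_profile :: "real \<Rightarrow> (real \<Rightarrow> real) \<Rightarrow> bool" where
  "wall_profile \<kappa> \<theta> \<longleftrightarrow>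
    (\<forall>\<xi>. sin (\<theta> \<xi>) \<noteq> 0 \<and> (\<theta> has_real_derivative \<kappa> * sin (\<theta> \<xi>)) (at \<xi>))"

text \<open>Translations by \<open>2\<pi>\<close> and the reflection \<open>\<theta> \<mapsto> -\<theta>\<close> are the symmetries of \<open>\<theta>' = \<kappa> sin \<theta>\<close> that bring
  any nonconstant solution into the strip \<open>(0, \<pi>)\<close> where \<open>kink\<close> lives.\<close>

lemma sin_nonzero_representative:
  fixes t :: real
  assumes "sin t \<noteq> 0"
  obtains \<epsilon> :: real and n :: int where "\<epsilon> \<in> {-1, 1}" "0 < \<epsilon> * (t - 2 * pi * of_int n)"
    "\<epsilon> * (t - 2 * pi * of_int n) < pi"
proof -
  define n where "n = \<lfloor>(t + pi) / (2 * pi)\<rfloor>"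
  define r where "r = t - 2 * pi * of_int n"
  have "of_int n \<le> (t + pi) / (2 * pi)" "(t + pi) / (2 * pi) < of_int n + 1"
    unfolding n_def by linarith+
  then have r: "- pi \<le> r" "r < pi"
    by (auto simp: r_def field_simps)
  have "sin r \<noteq> 0"
    using assms sin.plus_of_int[of t "- n"] by (simp add: r_def algebra_simps)
  then have "r \<noteq> 0" "r \<noteq> - pi" by auto
  then show thesis
    using r that[of 1 n] that[of "- 1" n] unfolding r_def by (cases "r > 0") (auto simp: r_def)
qed

lemma kink_imp_wall_profile:
  assumes "\<epsilon> \<in> {-1, 1}" "\<And>\<xi>. \<theta> \<xi> = \<epsilon> * kink (\<kappa> * (\<xi> - \<xi>\<^sub>0)) + 2 * pi * of_int n"
  shows "wall_profile \<kappa> \<theta>"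
proof -
  have s: "sin (\<theta> \<xi>) = \<epsilon> * sin (kink (\<kappa> * (\<xi> - \<xi>\<^sub>0)))" for \<xi>
    using assms(1) sin.plus_of_int[of "\<epsilon> * kink (\<kappa> * (\<xi> - \<xi>\<^sub>0))" n]
    by (auto simp: assms(2) mult_ac)
  have "sin (kink z) \<noteq> 0" for z
    using sin_gt_zero[OF kink_bounds] by (metis less_irrefl)
  moreover have "(\<theta> has_real_derivative \<kappa> * sin (\<theta> \<xi>)) (at \<xi>)" for \<xi>
    unfolding s unfolding assms(2)[abs_def]
    by (auto intro!: derivative_eq_intros DERIV_chain2[OF kink_has_derivative])
  ultimately show ?thesis
    using assms(1) by (auto simp: wall_profile_def s)
qed

text \<open>After normalisation to \<open>(0, \<pi>)\<close> the equation becomes linear in \<open>tan (w/2)\<close>, which therefore is a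
  positive multiple of \<open>exp (\<kappa> \<xi>)\<close>; as \<open>\<kappa> \<noteq> 0\<close>, the multiple is absorbed by a translation of \<open>\<xi>\<close>.\<close>

lemma wall_profile_imp_kink:
  assumes "\<kappa> \<noteq> 0" and prof: "wall_profile \<kappa> \<theta>"
  shows "\<exists>\<xi>\<^sub>0. \<exists>\<epsilon>\<in>{-1, 1}. \<exists>n :: int. \<forall>\<xi>.
      \<theta> \<xi> = \<epsilon> * kink (\<kappa> * (\<xi> - \<xi>\<^sub>0)) + 2 * pi * of_int n"
proof -
  have sn: "sin (\<theta> \<xi>) \<noteq> 0" and ode: "(\<theta> has_real_derivative \<kappa> * sin (\<theta> \<xi>)) (at \<xi>)" for \<xi>
    using prof by (auto simp: wall_profile_def)
  obtain \<epsilon> :: real and n :: int where \<epsilon>: "\<epsilon> \<in> {-1, 1}"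
    and w0: "0 < \<epsilon> * (\<theta> 0 - 2 * pi * of_int n)" "\<epsilon> * (\<theta> 0 - 2 * pi * of_int n) < pi"
    using sin_nonzero_representative[OF sn[of 0]] by metis
  define w where "w \<xi> = \<epsilon> * (\<theta> \<xi> - 2 * pi * of_int n)" for \<xi>
  have sw: "sin (w \<xi>) = \<epsilon> * sin (\<theta> \<xi>)" for \<xi>
    using \<epsilon> sin.plus_of_int[of "\<theta> \<xi>" "- n"] sin.plus_of_int[of "- \<theta> \<xi>" n]
    by (auto simp: w_def algebra_simps)
  have wode: "(w has_real_derivative \<kappa> * sin (w \<xi>)) (at \<xi>)" for \<xi>
    unfolding sw unfolding w_def[abs_def] by (auto intro!: derivative_eq_intros ode)
  have wsn: "sin (w \<xi>) \<noteq> 0" for \<xi>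
    using \<epsilon> sn by (auto simp: sw)
  \<comment> \<open>The trajectory cannot leave \<open>(0, \<pi>)\<close>, since it would have to take the value 0 or \<open>\<pi>\<close>.\<close>
  have "connected (range w)"
    by (intro connected_continuous_image continuous_at_imp_continuous_on ballI
        DERIV_isCont[OF wode] connected_UNIV)
  then have icc: "{w \<xi>..w \<eta>} \<subseteq> range w" for \<xi> \<eta>
    by (rule connected_contains_Icc) auto
  have w: "0 < w \<xi>" "w \<xi> < pi" for \<xi>
  proof -
    have nz: "w \<eta> \<noteq> 0" "w \<eta> \<noteq> pi" for \<eta>
      using wsn[of \<eta>] by auto
    have 0: "0 < w 0" "w 0 < pi"
      using w0 by (simp_all add: w_def)
    show "0 < w \<xi>"
    proof (rule ccontr)
      assume "\<not> 0 < w \<xi>"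
      then have "0 \<in> range w" using icc[of \<xi> 0] 0 by (simp add: subset_eq)
      then show False using nz(1) by (metis rangeE)
    qed
    show "w \<xi> < pi"
    proof (rule ccontr)
      assume "\<not> w \<xi> < pi"
      then have "pi \<in> range w" using icc[of 0 \<xi>] 0 by (simp add: subset_eq)
      then show False using nz(2) by (metis rangeE)
    qed
  qed
  define T where "T \<xi> = tan (w \<xi> / 2) * exp (- \<kappa> * \<xi>)" for \<xi>
  have cpos: "cos (w \<xi> / 2) > 0" for \<xi>
    using w[of \<xi>] by (intro cos_gt_zero) auto
  have tan_ode: "((\<lambda>\<xi>. tan (w \<xi> / 2)) has_real_derivative \<kappa> * tan (w \<xi> / 2)) (at \<xi>)" for \<xi>
  proof -
    have "((\<lambda>\<xi>. tan (w \<xi> / 2)) has_real_derivative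
        inverse ((cos (w \<xi> / 2))\<^sup>2) * (\<kappa> * sin (w \<xi>) / 2)) (at \<xi>)"
      using cpos[of \<xi>] by (intro DERIV_chain2[OF DERIV_tan] DERIV_cdivide wode) simp
    moreover have "inverse ((cos (w \<xi> / 2))\<^sup>2) * (\<kappa> * sin (w \<xi>) / 2) = \<kappa> * tan (w \<xi> / 2)"
      using cpos[of \<xi>] sin_double[of "w \<xi> / 2"]
      by (simp add: tan_def power2_eq_square field_simps)
    ultimately show ?thesis by (simp only:)
  qed
  have "(T has_real_derivative 0) (at \<xi>)" for \<xi>
  proof -
    have "((\<lambda>\<xi>. exp (- \<kappa> * \<xi>)) has_real_derivative - \<kappa> * exp (- \<kappa> * \<xi>)) (at \<xi>)"
      by (auto intro!: derivative_eq_intros)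
    from DERIV_mult[OF tan_ode this] show ?thesis
      by (simp add: T_def[abs_def] mult_ac)
  qed
  then have Tc: "T \<xi> = T 0" for \<xi>
    using DERIV_isconst_all by blast
  have T0: "T 0 > 0"
    using w[of 0] by (auto simp: T_def intro!: tan_gt_zero)
  define \<xi>\<^sub>0 where "\<xi>\<^sub>0 = - ln (T 0) / \<kappa>"
  have "tan (w \<xi> / 2) = exp (\<kappa> * (\<xi> - \<xi>\<^sub>0))" for \<xi>
  proof -
    have "tan (w \<xi> / 2) = T 0 * exp (\<kappa> * \<xi>)"
      using Tc[of \<xi>] by (simp add: T_def exp_minus field_simps)
    also have "\<dots> = exp (\<kappa> * (\<xi> - \<xi>\<^sub>0))"
      using T0 assms(1) by (simp add: \<xi>\<^sub>0_def distrib_left exp_add)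
    finally show ?thesis .
  qed
  moreover have "w \<xi> = 2 * arctan (tan (w \<xi> / 2))" for \<xi>
    using w[of \<xi>] by (simp add: arctan_tan)
  ultimately have "w \<xi> = kink (\<kappa> * (\<xi> - \<xi>\<^sub>0))" for \<xi>
    by (simp add: kink_def)
  moreover have "\<theta> \<xi> = \<epsilon> * w \<xi> + 2 * pi * of_int n" for \<xi>
    using \<epsilon> by (auto simp: w_def)
  ultimately have "\<theta> \<xi> = \<epsilon> * kink (\<kappa> * (\<xi> - \<xi>\<^sub>0)) + 2 * pi * of_int n" for \<xi>
    by simp
  then show ?thesis using \<epsilon> by (intro exI bexI allI)
qed

lemma filterlim_shift_real:
  fixes d :: real
  shows "filterlim (\<lambda>x. x - d) at_bot at_bot" "filterlim (\<lambda>x. x - d) at_top at_top"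
proof -
  show "filterlim (\<lambda>x. x - d) at_bot at_bot"
    using filterlim_tendsto_add_at_bot_iff[OF tendsto_const[of "- d"], THEN iffD2,
        OF filterlim_ident] by simp
  show "filterlim (\<lambda>x. x - d) at_top at_top"
    using filterlim_tendsto_add_at_top[OF tendsto_const[of "- d"] filterlim_ident] by simp
qed

lemma wall_profile_tendsto:
  assumes "\<kappa> \<noteq> 0" "wall_profile \<kappa> \<theta>"
  shows "((\<lambda>\<xi>. cos (\<theta> \<xi>)) \<longlongrightarrow> sgn \<kappa>) at_bot" "((\<lambda>\<xi>. cos (\<theta> \<xi>)) \<longlongrightarrow> - sgn \<kappa>) at_top"
proof -
  obtain \<xi>\<^sub>0 \<epsilon> :: real and n :: int where \<epsilon>: "\<epsilon> \<in> {-1, 1}"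
    and \<theta>: "\<forall>\<xi>. \<theta> \<xi> = \<epsilon> * kink (\<kappa> * (\<xi> - \<xi>\<^sub>0)) + 2 * pi * of_int n"
    using wall_profile_imp_kink[OF assms] by (elim exE bexE)
  have c: "cos (\<theta> \<xi>) = cos (kink (\<kappa> * (\<xi> - \<xi>\<^sub>0)))" for \<xi>
    using \<epsilon> cos.plus_of_int[of "\<epsilon> * kink (\<kappa> * (\<xi> - \<xi>\<^sub>0))" n] by (auto simp: \<theta>[rule_format] mult_ac)
  have bot: "((\<lambda>\<xi>. cos (kink (f \<xi>))) \<longlongrightarrow> 1) F" if "filterlim f at_bot F"
    for f and F :: "real filter"
    using tendsto_cos[OF filterlim_compose[OF kink_tendsto_at_bot that]] by simp
  have top: "((\<lambda>\<xi>. cos (kink (f \<xi>))) \<longlongrightarrow> - 1) F" if "filterlim f at_top F"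
    for f and F :: "real filter"
    using tendsto_cos[OF filterlim_compose[OF kink_tendsto_at_top that]] by simp
  note sh = filterlim_shift_real[of \<xi>\<^sub>0]
  consider "\<kappa> > 0" | "\<kappa> < 0" using assms(1) by linarith
  then have "((\<lambda>\<xi>. cos (\<theta> \<xi>)) \<longlongrightarrow> sgn \<kappa>) at_bot \<and> ((\<lambda>\<xi>. cos (\<theta> \<xi>)) \<longlongrightarrow> - sgn \<kappa>) at_top"
  proof cases
    case 1
    then have "filterlim (\<lambda>\<xi>. \<kappa> * (\<xi> - \<xi>\<^sub>0)) at_bot at_bot" "filterlim (\<lambda>\<xi>. \<kappa> * (\<xi> - \<xi>\<^sub>0)) at_top at_top"
      using filterlim_tendsto_pos_mult_at_bot[OF tendsto_const _ sh(1)]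
        filterlim_tendsto_pos_mult_at_top[OF tendsto_const _ sh(2)] by blast+
    then show ?thesis
      using 1 bot top by (simp_all add: c)
  next
    case 2
    then have "filterlim (\<lambda>\<xi>. \<kappa> * (\<xi> - \<xi>\<^sub>0)) at_top at_bot" "filterlim (\<lambda>\<xi>. \<kappa> * (\<xi> - \<xi>\<^sub>0)) at_bot at_top"
      using filterlim_tendsto_neg_mult_at_top_iff[OF tendsto_const, THEN iffD2, OF _ sh(1)]
        filterlim_tendsto_neg_mult_at_bot[OF tendsto_const _ sh(2)] by blast+
    then show ?thesis
      using 2 bot top by (simp_all add: c)
  qed
  then show "((\<lambda>\<xi>. cos (\<theta> \<xi>)) \<longlongrightarrow> sgn \<kappa>) at_bot" "((\<lambda>\<xi>. cos (\<theta> \<xi>)) \<longlongrightarrow> - sgn \<kappa>) at_top"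
    by blast+
qed

text \<open>The azimuthal factor has modulus one, so the planar component vanishes in the limit as soon as
  \<open>cos \<theta>\<close> tends to 1 or -1.\<close>

lemma magnetization_tendsto:
  assumes "((\<lambda>\<xi>. cos (\<theta> (\<xi> - s * t))) \<longlongrightarrow> \<tau>) F" "\<tau>\<^sup>2 = 1"
  shows "((\<lambda>x. magnetization s \<Omega> \<phi> \<theta> x t) \<longlongrightarrow> (0, \<tau>)) F"
proof -
  have "((\<lambda>x. sqrt (1 - (cos (\<theta> (x - s * t)))\<^sup>2)) \<longlongrightarrow> sqrt (1 - \<tau>\<^sup>2)) F"
    by (intro tendsto_intros assms)
  moreover have "sqrt (1 - (cos y)\<^sup>2) = \<bar>sin y\<bar>" for y :: real
    by (metis real_sqrt_abs sin_squared_eq)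
  ultimately have "((\<lambda>x. \<bar>sin (\<theta> (x - s * t))\<bar>) \<longlongrightarrow> 0) F"
    using assms(2) by simp
  then have "((\<lambda>x. cis (\<phi> (x - s * t) + \<Omega> * t) * of_real (sin (\<theta> (x - s * t)))) \<longlongrightarrow> 0) F"
    by (subst tendsto_norm_zero_iff[symmetric]) (simp add: norm_mult)
  then show ?thesis
    unfolding magnetization_def by (intro tendsto_Pair assms)
qed

lemma wall_profile_heteroclinic:
  assumes "\<kappa> \<noteq> 0" "wall_profile \<kappa> \<theta>"
  shows "heteroclinic_front (magnetization s \<Omega> \<phi> \<theta>)"
  unfolding heteroclinic_front_def
proof (intro bexI allI conjI)
  show "sgn \<kappa> \<in> {-1, 1}" using assms(1) by (auto simp: sgn_if)
  have sq: "(sgn \<kappa>)\<^sup>2 = 1" "(- sgn \<kappa>)\<^sup>2 = 1" using assms(1) by (auto simp: sgn_if)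
  fix t
  show "((\<lambda>x. magnetization s \<Omega> \<phi> \<theta> x t) \<longlongrightarrow> (0, sgn \<kappa>)) at_bot"
    "((\<lambda>x. magnetization s \<Omega> \<phi> \<theta> x t) \<longlongrightarrow> (0, - sgn \<kappa>)) at_top"
    by (rule magnetization_tendsto sq
        filterlim_compose[OF wall_profile_tendsto(1)[OF assms] filterlim_shift_real(1)]
        filterlim_compose[OF wall_profile_tendsto(2)[OF assms] filterlim_shift_real(2)])+
qed

text \<open>The shift \<open>(x, t) \<mapsto> (x + s r, t + r)\<close> leaves the travelling coordinate \<open>x - s t\<close> invariant, so only
  the phase \<open>\<Omega> t\<close> advances.\<close>

lemma magnetization_oscillating: "oscillating s \<Omega> (magnetization s \<Omega> \<phi> \<theta>)"
  unfolding oscillating_def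
proof (intro allI)
  fix x t r
  have shift: "x + s * r - s * (t + r) = x - s * t"
    by (simp add: algebra_simps)
  have "cis (\<phi> (x - s * t) + \<Omega> * (t + r)) = cis (\<Omega> * r) * cis (\<phi> (x - s * t) + \<Omega> * t)"
    by (simp add: cis_mult distrib_left add_ac)
  then show "magnetization s \<Omega> \<phi> \<theta> (x + s * r) (t + r)
      = (cis (\<Omega> * r) * fst (magnetization s \<Omega> \<phi> \<theta> x t), snd (magnetization s \<Omega> \<phi> \<theta> x t))"
    by (simp add: magnetization_def shift mult.assoc)
qed

lemma wall_profile_oscillating_front:
  assumes "\<sigma> * sqrt (- \<mu>) \<noteq> 0" "wall_profile (\<sigma> * sqrt (- \<mu>)) \<theta>"
  shows "oscillating_front \<mu> s \<Omega> \<sigma> \<theta> q"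
  using assms(2) wall_profile_heteroclinic[OF assms] magnetization_oscillating
  by (simp add: oscillating_front_def wall_profile_def)

lemma smooth_on_kink: "smooth_on UNIV kink"
  by (rule smooth_on_autonomous_ode[OF _ _ _ smooth_on_sin])
    (auto intro: kink_has_derivative)

lemma wall_profile_kink: "wall_profile \<kappa> (\<lambda>\<xi>. kink (\<kappa> * \<xi>))"
  using kink_imp_wall_profile[of 1 "\<lambda>\<xi>. kink (\<kappa> * \<xi>)" \<kappa> 0 0] by simp

lemma wall_profile_iff_kink:
  assumes "\<kappa> \<noteq> 0"
  shows "wall_profile \<kappa> \<theta> \<longleftrightarrow>
    (\<exists>\<xi>\<^sub>0. \<exists>\<epsilon>\<in>{-1, 1}. \<exists>n :: int. \<forall>\<xi>.
      \<theta> \<xi> = \<epsilon> * kink (\<kappa> * (\<xi> - \<xi>\<^sub>0)) + 2 * pi * of_int n)"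
proof
  assume "wall_profile \<kappa> \<theta>"
  then show "\<exists>\<xi>\<^sub>0. \<exists>\<epsilon>\<in>{-1, 1}. \<exists>n :: int. \<forall>\<xi>.
      \<theta> \<xi> = \<epsilon> * kink (\<kappa> * (\<xi> - \<xi>\<^sub>0)) + 2 * pi * of_int n"
    by (rule wall_profile_imp_kink[OF assms])
next
  assume "\<exists>\<xi>\<^sub>0. \<exists>\<epsilon>\<in>{-1, 1}. \<exists>n :: int. \<forall>\<xi>.
      \<theta> \<xi> = \<epsilon> * kink (\<kappa> * (\<xi> - \<xi>\<^sub>0)) + 2 * pi * of_int n"
  then obtain \<xi>\<^sub>0 \<epsilon> :: real and n :: int where "\<epsilon> \<in> {-1, 1}"
    and "\<forall>\<xi>. \<theta> \<xi> = \<epsilon> * kink (\<kappa> * (\<xi> - \<xi>\<^sub>0)) + 2 * pi * of_int n"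
    by (elim exE bexE)
  then show "wall_profile \<kappa> \<theta>"
    by (intro kink_imp_wall_profile) auto
qed

section \<open>Structures without azimuthal profile\<close>

text \<open>The range of \<open>cos \<theta>\<close> is connected, hence infinite unless it is a single point. Identities along the
  profile that are polynomial in \<open>cos \<theta>\<close> therefore hold coefficientwise.\<close>

lemma infinite_range_cos:
  assumes "\<And>\<xi>. sin (\<theta> \<xi>) \<noteq> 0" "\<And>\<xi>. (\<theta> has_real_derivative p \<xi>) (at \<xi>)" "p \<xi>\<^sub>1 \<noteq> 0"
  shows "infinite (range (\<lambda>\<xi>. cos (\<theta> \<xi>)))" (is "infinite (range ?u)")
proof
  assume fin: "finite (range ?u)"
  have d: "(?u has_real_derivative - sin (\<theta> \<xi>) * p \<xi>) (at \<xi>)" for \<xi>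
    by (auto intro!: derivative_eq_intros assms(2))
  then have "connected (range ?u)"
    by (intro connected_continuous_image continuous_at_imp_continuous_on ballI
        DERIV_isCont[OF d] connected_UNIV)
  then obtain a where "range ?u = {a}"
    using connected_finite_iff_sing fin by (metis UNIV_not_empty image_is_empty)
  then have "?u = (\<lambda>_. a)" by auto
  then have "- sin (\<theta> \<xi>\<^sub>1) * p \<xi>\<^sub>1 = 0"
    using d[of \<xi>\<^sub>1] DERIV_unique[OF _ DERIV_const] by metis
  then show False using assms by auto
qed

lemma affine_eq_on_infinite:
  fixes X :: "real set"
  assumes "infinite X" "\<And>u. u \<in> X \<Longrightarrow> a + b * u = 0"
  shows "a = 0" "b = 0"
proof -
  obtain u v where uv: "u \<in> X" "v \<in> X" "u \<noteq> v"
    using assms(1) by (metis finite.emptyI finite_insert finite_subset insertCI subsetI)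
  have "b * (u - v) = (a + b * u) - (a + b * v)" by (simp add: algebra_simps)
  also have "\<dots> = 0" using assms(2)[OF uv(1)] assms(2)[OF uv(2)] by simp
  finally show "b = 0" using uv(3) by simp
  then show "a = 0" using assms(2)[OF uv(1)] by simp
qed

lemma denominator_pos:
  fixes c :: real
  assumes "\<bar>c\<bar> < 1"
  shows "1 + c * cos y > 0"
proof -
  have "\<bar>c * cos y\<bar> \<le> \<bar>c\<bar> * 1"
    unfolding abs_mult by (intro mult_left_mono) auto
  then show ?thesis using assms by linarith
qed

text \<open>With \<open>q = 0\<close> the third structure equation loses its derivative and becomes an algebraic constraint
  on \<open>(\<theta>, p)\<close>; this overdetermination is what makes the homogeneous structures rigid.\<close>

lemma homogeneous_equations:
  assumes "coherent_structure \<alpha> \<mu> h \<beta> c s \<Omega> \<theta> p q" "\<And>\<xi>. q \<xi> = 0"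
  shows "sin (\<theta> \<xi>) \<noteq> 0" "(\<theta> has_real_derivative p \<xi>) (at \<xi>)"
    "(p has_real_derivative sin (\<theta> \<xi>) * (h - \<mu> * cos (\<theta> \<xi>) - \<Omega>) - \<alpha> * s * p \<xi>) (at \<xi>)"
    "s * p \<xi> = sin (\<theta> \<xi>) * (\<alpha> * \<Omega> - \<beta> / (1 + c * cos (\<theta> \<xi>)))"
proof -
  note cs = assms(1)[unfolded coherent_structure_def, rule_format, of \<xi>]
  show sn: "sin (\<theta> \<xi>) \<noteq> 0" and "(\<theta> has_real_derivative p \<xi>) (at \<xi>)"
    "(p has_real_derivative sin (\<theta> \<xi>) * (h - \<mu> * cos (\<theta> \<xi>) - \<Omega>) - \<alpha> * s * p \<xi>) (at \<xi>)"
    using cs by (auto simp: assms(2))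
  have "q = (\<lambda>_. 0)" using assms(2) by auto
  then have "((\<lambda>_. 0) has_real_derivative
      \<alpha> * \<Omega> - \<beta> / (1 + c * cos (\<theta> \<xi>)) - s / sin (\<theta> \<xi>) * p \<xi>) (at \<xi>)"
    using cs by auto
  then have "\<alpha> * \<Omega> - \<beta> / (1 + c * cos (\<theta> \<xi>)) - s / sin (\<theta> \<xi>) * p \<xi> = 0"
    using DERIV_unique[OF _ DERIV_const] by blast
  then show "s * p \<xi> = sin (\<theta> \<xi>) * (\<alpha> * \<Omega> - \<beta> / (1 + c * cos (\<theta> \<xi>)))"
    using sn by (simp add: field_simps)
qed

lemma not_equilibrium_imp_moving:
  assumes "\<not> equilibrium \<theta> p q" "\<And>\<xi>. q \<xi> = 0" "\<And>\<xi>. (\<theta> has_real_derivative p \<xi>) (at \<xi>)"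
  obtains \<xi>\<^sub>1 where "p \<xi>\<^sub>1 \<noteq> 0"
proof (rule ccontr)
  assume "\<not> thesis"
  then have p: "p \<xi> = 0" for \<xi> using that by blast
  then have "\<theta> \<xi> = \<theta> 0" for \<xi>
    using assms(3) DERIV_isconst_all[of \<theta>] by auto
  then show False
    using assms(1,2) p unfolding equilibrium_def by blast
qed

text \<open>Along a wall profile the constraint and the second-order equation are, after division by
  \<open>sin \<theta>\<close>, affine in \<open>u = cos \<theta>\<close> (the former once multiplied by \<open>1 + c u\<close>). Comparing coefficients gives
  exactly these relations between the parameters. The equations for \<open>\<alpha> \<Omega>\<close> and \<open>h\<close> are linear in \<open>s\<close>, so
  \<open>s = 0\<close> needs no separate treatment.\<close>

lemma wall_profile_homogeneous_iff:
  assumes c: "\<bar>c\<bar> < 1" and \<kappa>: "\<kappa> \<noteq> 0" and prof: "wall_profile \<kappa> \<theta>"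
  shows "homogeneous_coherent_structure \<alpha> \<mu> h \<beta> c s \<Omega> \<theta> p q \<longleftrightarrow>
    p = (\<lambda>\<xi>. \<kappa> * sin (\<theta> \<xi>)) \<and> q = (\<lambda>_. 0) \<and> (c = 0 \<or> \<beta> = 0) \<and>
    \<alpha> * \<Omega> = \<beta> + s * \<kappa> \<and> h = \<Omega> + \<alpha> * s * \<kappa> \<and> \<kappa>\<^sup>2 = - \<mu>"
    (is "?L \<longleftrightarrow> ?R")
proof -
  have sn: "sin (\<theta> \<xi>) \<noteq> 0" and ode: "(\<theta> has_real_derivative \<kappa> * sin (\<theta> \<xi>)) (at \<xi>)" for \<xi>
    using prof by (auto simp: wall_profile_def)
  have pode: "((\<lambda>\<xi>. \<kappa> * sin (\<theta> \<xi>)) has_real_derivative \<kappa>\<^sup>2 * cos (\<theta> \<xi>) * sin (\<theta> \<xi>)) (at \<xi>)" for \<xi>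
    by (auto intro!: derivative_eq_intros ode simp: power2_eq_square)
  have inf: "infinite (range (\<lambda>\<xi>. cos (\<theta> \<xi>)))"
    by (rule infinite_range_cos[where \<theta> = \<theta>, OF sn ode, of 0]) (use \<kappa> sn in auto)
  show ?thesis
  proof
    assume ?L
    then have cs: "coherent_structure \<alpha> \<mu> h \<beta> c s \<Omega> \<theta> p q" and q: "\<And>\<xi>. q \<xi> = 0"
      by (auto simp: homogeneous_coherent_structure_def)
    note eqs = homogeneous_equations[OF cs q]
    have p: "p = (\<lambda>\<xi>. \<kappa> * sin (\<theta> \<xi>))"
      using DERIV_unique[OF eqs(2) ode] by blast
    have "(\<alpha> * \<Omega> - \<beta> - s * \<kappa>) + (c * (\<alpha> * \<Omega> - s * \<kappa>)) * u = 0"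
      if "u \<in> range (\<lambda>\<xi>. cos (\<theta> \<xi>))" for u
    proof -
      obtain \<xi> where u: "u = cos (\<theta> \<xi>)" using \<open>u \<in> _\<close> by blast
      have "s * \<kappa> = \<alpha> * \<Omega> - \<beta> / (1 + c * u)"
        using eqs(4)[of \<xi>] sn[of \<xi>] by (simp add: p u)
      then show ?thesis
        using denominator_pos[OF c, of "\<theta> \<xi>"] by (simp add: u field_simps)
    qed
    note 1 = affine_eq_on_infinite[OF inf this]
    have "(h - \<Omega> - \<alpha> * s * \<kappa>) + (- \<mu> - \<kappa>\<^sup>2) * u = 0"
      if "u \<in> range (\<lambda>\<xi>. cos (\<theta> \<xi>))" for u
    proof -
      obtain \<xi> where u: "u = cos (\<theta> \<xi>)" using \<open>u \<in> _\<close> by blast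
      have "\<kappa>\<^sup>2 * u * sin (\<theta> \<xi>) = sin (\<theta> \<xi>) * (h - \<mu> * u - \<Omega>) - \<alpha> * s * (\<kappa> * sin (\<theta> \<xi>))"
        using DERIV_unique[OF pode eqs(3)[unfolded p]] by (simp add: u)
      then have "sin (\<theta> \<xi>) * (h - \<Omega> - \<alpha> * s * \<kappa> + (- \<mu> - \<kappa>\<^sup>2) * u) = 0"
        by (simp add: algebra_simps)
      then show ?thesis using sn[of \<xi>] by simp
    qed
    note 2 = affine_eq_on_infinite[OF inf this]
    show ?R
      using 1 2 p q by auto
  next
    assume R: ?R
    then have p: "p = (\<lambda>\<xi>. \<kappa> * sin (\<theta> \<xi>))" and q: "q = (\<lambda>_. 0)" and cb: "c = 0 \<or> \<beta> = 0"
      and e: "\<alpha> * \<Omega> = \<beta> + s * \<kappa>" "h = \<Omega> + \<alpha> * s * \<kappa>" "\<mu> = - \<kappa>\<^sup>2" by auto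
    have "coherent_structure \<alpha> \<mu> h \<beta> c s \<Omega> \<theta> p q"
      unfolding coherent_structure_def
    proof (intro allI conjI)
      fix \<xi>
      show "sin (\<theta> \<xi>) \<noteq> 0" "(\<theta> has_real_derivative p \<xi>) (at \<xi>)" using sn ode p by auto
      show "(p has_real_derivative
          sin (\<theta> \<xi>) * (h + ((q \<xi>)\<^sup>2 - \<mu>) * cos (\<theta> \<xi>) - (\<Omega> - s * q \<xi>)) - \<alpha> * s * p \<xi>) (at \<xi>)"
        using pode[of \<xi>] by (simp add: p q e(2,3) algebra_simps)
      have "\<beta> / (1 + c * cos (\<theta> \<xi>)) = \<beta>" using cb by auto
      then show "(q has_real_derivative
          \<alpha> * (\<Omega> - s * q \<xi>) - \<beta> / (1 + c * cos (\<theta> \<xi>))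
          - (s + 2 * cos (\<theta> \<xi>) * q \<xi>) / sin (\<theta> \<xi>) * p \<xi>) (at \<xi>)"
        using sn by (simp add: p q e(1))
    qed
    moreover have "\<not> equilibrium \<theta> p q"
    proof
      assume "equilibrium \<theta> p q"
      then have "\<exists>a. \<forall>\<xi>. \<theta> \<xi> = a" unfolding equilibrium_def by blast
      then have "finite (range (\<lambda>\<xi>. cos (\<theta> \<xi>)))" by auto
      then show False using inf by blast
    qed
    ultimately show ?L using q by (simp add: homogeneous_coherent_structure_def)
  qed
qed

text \<open>For \<open>s \<noteq> 0\<close> the constraint determines \<open>p\<close> as a function of \<open>\<theta>\<close>, and inserting it into the second
  equation yields a rational identity in \<open>u = cos \<theta>\<close> that holds on an infinite set. Once the
  denominator \<open>D = 1 + c u\<close> is cleared it is a polynomial identity, so it may be evaluated at the pole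
  \<open>u = -1/c\<close>, although this value lies outside \<open>[-1, 1]\<close>: what survives there is
  \<open>\<beta>\<^sup>2 (c\<^sup>2 - 1) / c = 0\<close>.\<close>

lemma moving_homogeneous_imp_beta_or_c_zero:
  assumes c: "\<bar>c\<bar> < 1" and s: "s \<noteq> 0"
    and hcs: "homogeneous_coherent_structure \<alpha> \<mu> h \<beta> c s \<Omega> \<theta> p q"
  shows "c = 0 \<or> \<beta> = 0"
proof (rule ccontr)
  assume "\<not> (c = 0 \<or> \<beta> = 0)"
  then have c0: "c \<noteq> 0" and \<beta>0: "\<beta> \<noteq> 0" by auto
  have cs: "coherent_structure \<alpha> \<mu> h \<beta> c s \<Omega> \<theta> p q" and q: "\<And>\<xi>. q \<xi> = 0"
    and neq: "\<not> equilibrium \<theta> p q"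
    using hcs by (auto simp: homogeneous_coherent_structure_def)
  note eqs = homogeneous_equations[OF cs q]
  obtain \<xi>\<^sub>1 where "p \<xi>\<^sub>1 \<noteq> 0"
    using not_equilibrium_imp_moving[OF neq q eqs(2)] by blast
  then have inf: "infinite (range (\<lambda>\<xi>. cos (\<theta> \<xi>)))"
    using infinite_range_cos eqs(1,2) by blast
  define D where "D = [:1, c:]"
  define N where "N = smult (\<alpha> * \<Omega>) D - [:\<beta>:]"
  \<comment> \<open>\<open>P\<close> is the difference of the two formulas for \<open>p'\<close> times \<open>D\<^sup>3\<close>, up to a factor \<open>s\<^sup>2 / sin \<theta>\<close>; here \<open>N = D G\<close>
      with \<open>G = \<alpha> \<Omega> - \<beta> / D\<close>.\<close>
  define P where "P = ([:0, 1:] * N * D - smult (\<beta> * c) [:1, 0, -1:]) * N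
    - smult (s\<^sup>2) (D ^ 2 * ([:h - \<Omega>, - \<mu>:] * D - smult \<alpha> N))"
  have "poly P (cos (\<theta> \<xi>)) = 0" for \<xi>
  proof -
    define u where "u = cos (\<theta> \<xi>)"
    define v where "v = sin (\<theta> \<xi>)"
    define d where "d = 1 + c * u"
    define G where "G = \<alpha> * \<Omega> - \<beta> / d"
    have v: "v \<noteq> 0" "v\<^sup>2 = 1 - u\<^sup>2" using eqs(1) by (auto simp: u_def v_def sin_squared_eq)
    have d: "d \<noteq> 0" using denominator_pos[OF c, of "\<theta> \<xi>"] by (simp add: d_def u_def)
    \<comment> \<open>The constraint, read as a formula for \<open>p\<close>; differentiating it gives a second formula for \<open>p'\<close>.\<close>
    have pG: "p \<xi> = v * G / s"
      using eqs(4)[of \<xi>] s by (simp add: v_def G_def d_def u_def field_simps)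
    have dG: "((\<lambda>\<xi>. \<alpha> * \<Omega> - \<beta> / (1 + c * cos (\<theta> \<xi>))) has_real_derivative
        - \<beta> * c * v / d\<^sup>2 * p \<xi>) (at \<xi>)"
    proof -
      have dd: "((\<lambda>\<xi>. 1 + c * cos (\<theta> \<xi>)) has_real_derivative - c * v * p \<xi>) (at \<xi>)"
        by (auto intro!: derivative_eq_intros eqs(2) simp: v_def)
      show ?thesis
        using DERIV_diff[OF DERIV_const DERIV_divide[OF DERIV_const dd], of "\<alpha> * \<Omega>" \<beta>] d
        by (simp add: u_def d_def power2_eq_square mult_ac)
    qed
    have dsin: "((\<lambda>\<xi>. sin (\<theta> \<xi>)) has_real_derivative u * p \<xi>) (at \<xi>)"
      by (auto intro!: derivative_eq_intros eqs(2) simp: u_def)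
    have "((\<lambda>\<xi>. s * p \<xi>) has_real_derivative
        (u * G + v * (- \<beta> * c * v / d\<^sup>2)) * p \<xi>) (at \<xi>)"
      unfolding eqs(4)
      using DERIV_mult[OF dsin dG] by (simp add: u_def v_def d_def G_def algebra_simps)
    moreover have "((\<lambda>\<xi>. s * p \<xi>) has_real_derivative
        s * (v * (h - \<mu> * u - \<Omega>) - \<alpha> * s * p \<xi>)) (at \<xi>)"
      by (auto intro!: derivative_eq_intros eqs(3) simp: u_def v_def)
    ultimately have "(u * G + v * (- \<beta> * c * v / d\<^sup>2)) * p \<xi>
        = s * (v * (h - \<mu> * u - \<Omega>) - \<alpha> * s * p \<xi>)"
      using DERIV_unique by blast
    then have "v * ((u * G - \<beta> * c * v\<^sup>2 / d\<^sup>2) * G - s\<^sup>2 * (h - \<mu> * u - \<Omega> - \<alpha> * G)) = 0"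
      using s by (simp add: pG field_simps power2_eq_square)
    then have E: "(u * G - \<beta> * c * (1 - u\<^sup>2) / d\<^sup>2) * G - s\<^sup>2 * (h - \<mu> * u - \<Omega> - \<alpha> * G) = 0"
      using v by simp
    have N: "\<alpha> * \<Omega> * d - \<beta> = G * d" using d by (simp add: G_def field_simps)
    have "poly P u = (u * (\<alpha> * \<Omega> * d - \<beta>) * d - \<beta> * c * (1 - u\<^sup>2)) * (\<alpha> * \<Omega> * d - \<beta>)
        - s\<^sup>2 * (d\<^sup>2 * ((h - \<Omega> - \<mu> * u) * d - \<alpha> * (\<alpha> * \<Omega> * d - \<beta>)))"
      by (simp add: P_def N_def D_def d_def power2_eq_square algebra_simps)
    also have "\<dots> = d ^ 3 * ((u * G - \<beta> * c * (1 - u\<^sup>2) / d\<^sup>2) * G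
        - s\<^sup>2 * (h - \<mu> * u - \<Omega> - \<alpha> * G))"
      unfolding N using d by (simp add: field_simps power2_eq_square power3_eq_cube)
    also have "\<dots> = 0" using E by simp
    finally show ?thesis by (simp add: u_def)
  qed
  then have "range (\<lambda>\<xi>. cos (\<theta> \<xi>)) \<subseteq> {x. poly P x = 0}" by auto
  then have "P = 0" using inf poly_roots_finite finite_subset by blast
  then have "poly P (- 1 / c) = 0" by simp
  moreover have "poly P (- 1 / c) = \<beta>\<^sup>2 * (c\<^sup>2 - 1) / c"
    using c0 by (simp add: P_def N_def D_def field_simps power2_eq_square)
  ultimately have "c\<^sup>2 = 1" using c0 \<beta>0 by simp
  then show False using c by (simp add: power2_eq_1_iff) auto
qed

text \<open>When \<open>c = 0\<close> or \<open>\<beta> = 0\<close> the term \<open>\<beta> / (1 + c cos \<theta>)\<close> is the constant \<open>\<beta>\<close>, and the constraint reads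
  \<open>s \<theta>' = (\<alpha> \<Omega> - \<beta>) sin \<theta>\<close>.\<close>

lemma moving_homogeneous_imp_wall_profile:
  assumes c: "\<bar>c\<bar> < 1" and s: "s \<noteq> 0"
    and hcs: "homogeneous_coherent_structure \<alpha> \<mu> h \<beta> c s \<Omega> \<theta> p q"
  obtains \<kappa> where "\<kappa> \<noteq> 0" "wall_profile \<kappa> \<theta>"
proof -
  have cs: "coherent_structure \<alpha> \<mu> h \<beta> c s \<Omega> \<theta> p q" and q: "\<And>\<xi>. q \<xi> = 0"
    and neq: "\<not> equilibrium \<theta> p q"
    using hcs by (auto simp: homogeneous_coherent_structure_def)
  note eqs = homogeneous_equations[OF cs q]
  obtain \<xi>\<^sub>1 where p1: "p \<xi>\<^sub>1 \<noteq> 0"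
    using not_equilibrium_imp_moving[OF neq q eqs(2)] by blast
  define \<kappa> where "\<kappa> = (\<alpha> * \<Omega> - \<beta>) / s"
  have p: "p \<xi> = \<kappa> * sin (\<theta> \<xi>)" for \<xi>
    using eqs(4)[of \<xi>] s moving_homogeneous_imp_beta_or_c_zero[OF assms]
    by (auto simp: \<kappa>_def field_simps)
  show thesis
  proof (rule that)
    show "\<kappa> \<noteq> 0" using p p1 by auto
    show "wall_profile \<kappa> \<theta>" using eqs(1,2) by (simp add: wall_profile_def p)
  qed
qed

section \<open>The family of fronts\<close>

text \<open>Prescribing the front equation supplies the wall profile directly, so this criterion holds for all
  speeds, \<open>s = 0\<close> included.\<close>

lemma front_homogeneous_iff:
  assumes c: "\<bar>c\<bar> < 1" and \<sigma>: "\<sigma> \<in> {-1, 1}"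
  shows "(\<exists>p q. homogeneous_coherent_structure \<alpha> \<mu> h \<beta> c s \<Omega> \<theta> p q \<and>
      oscillating_front \<mu> s \<Omega> \<sigma> \<theta> q) \<longleftrightarrow>
    \<mu> < 0 \<and> wall_profile (\<sigma> * sqrt (- \<mu>)) \<theta> \<and> (c = 0 \<or> \<beta> = 0) \<and>
    \<alpha> * \<Omega> = \<beta> + s * (\<sigma> * sqrt (- \<mu>)) \<and> h = \<Omega> + \<alpha> * s * (\<sigma> * sqrt (- \<mu>))"
    (is "?L \<longleftrightarrow> ?R")
proof
  let ?\<kappa> = "\<sigma> * sqrt (- \<mu>)"
  assume ?L
  then obtain p q where hcs: "homogeneous_coherent_structure \<alpha> \<mu> h \<beta> c s \<Omega> \<theta> p q"
    and front: "oscillating_front \<mu> s \<Omega> \<sigma> \<theta> q" by blast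
  have cs: "coherent_structure \<alpha> \<mu> h \<beta> c s \<Omega> \<theta> p q" and q: "\<And>\<xi>. q \<xi> = 0"
    and neq: "\<not> equilibrium \<theta> p q"
    using hcs by (auto simp: homogeneous_coherent_structure_def)
  note eqs = homogeneous_equations[OF cs q]
  have prof: "wall_profile ?\<kappa> \<theta>"
    using front eqs(1) by (simp add: wall_profile_def oscillating_front_def)
  obtain \<xi>\<^sub>1 where "p \<xi>\<^sub>1 \<noteq> 0"
    using not_equilibrium_imp_moving[OF neq q eqs(2)] by blast
  moreover have "p \<xi>\<^sub>1 = ?\<kappa> * sin (\<theta> \<xi>\<^sub>1)"
    using eqs(2) prof DERIV_unique unfolding wall_profile_def by blast
  ultimately have \<kappa>: "?\<kappa> \<noteq> 0" by auto
  note R = wall_profile_homogeneous_iff[OF c \<kappa> prof, THEN iffD1, OF hcs]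
  then have "\<mu> < 0" using \<kappa> by (metis neg_0_less_iff_less zero_less_power2)
  then show ?R using R prof by blast
next
  let ?\<kappa> = "\<sigma> * sqrt (- \<mu>)"
  assume R: ?R
  then have \<kappa>: "?\<kappa> \<noteq> 0" "?\<kappa>\<^sup>2 = - \<mu>" using \<sigma> by (auto simp: power_mult_distrib)
  have prof: "wall_profile ?\<kappa> \<theta>" using R by blast
  then have "oscillating_front \<mu> s \<Omega> \<sigma> \<theta> (\<lambda>_. 0)"
    by (rule wall_profile_oscillating_front[OF \<kappa>(1)])
  moreover have "homogeneous_coherent_structure \<alpha> \<mu> h \<beta> c s \<Omega> \<theta> (\<lambda>\<xi>. ?\<kappa> * sin (\<theta> \<xi>)) (\<lambda>_. 0)"
    using wall_profile_homogeneous_iff[OF c \<kappa>(1) prof] R \<kappa>(2) by blast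
  ultimately show ?L by blast
qed

text \<open>Eliminating \<open>\<kappa>\<close>: the two linear relations give \<open>\<Omega>\<close> and \<open>s \<kappa> = (\<alpha> h - \<beta>) / (1 + \<alpha>\<^sup>2)\<close>, and squaring the
  latter gives the relation for \<open>s\<^sup>2\<close>.\<close>

lemma moving_parameters_iff:
  fixes \<alpha> \<mu> h \<beta> s \<Omega> :: real
  assumes s: "s \<noteq> 0"
  shows "(\<exists>\<kappa>. \<kappa> \<noteq> 0 \<and> \<alpha> * \<Omega> = \<beta> + s * \<kappa> \<and> h = \<Omega> + \<alpha> * s * \<kappa> \<and> \<kappa>\<^sup>2 = - \<mu>) \<longleftrightarrow>
    \<mu> < 0 \<and> \<Omega> = (h + \<alpha> * \<beta>) / (1 + \<alpha>\<^sup>2) \<and> s\<^sup>2 = - ((\<beta> - \<alpha> * h)\<^sup>2 / (\<mu> * (1 + \<alpha>\<^sup>2)\<^sup>2))"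
    (is "?L \<longleftrightarrow> ?R")
proof -
  have a: "1 + \<alpha>\<^sup>2 > 0" by (simp add: add_pos_nonneg)
  show ?thesis
  proof
    assume ?L
    then obtain \<kappa> where \<kappa>: "\<kappa> \<noteq> 0" "\<alpha> * \<Omega> = \<beta> + s * \<kappa>" "h = \<Omega> + \<alpha> * s * \<kappa>" "\<kappa>\<^sup>2 = - \<mu>"
      by blast
    have \<mu>: "\<mu> < 0" using \<kappa>(1,4) by (metis neg_0_less_iff_less zero_less_power2)
    have "h + \<alpha> * \<beta> = \<Omega> + \<alpha> * (\<beta> + s * \<kappa>)" by (simp add: \<kappa>(3) algebra_simps)
    also have "\<dots> = \<Omega> * (1 + \<alpha>\<^sup>2)" 
      unfolding \<kappa>(2)[symmetric] by (simp add: power2_eq_square algebra_simps)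
    finally have \<Omega>: "\<Omega> = (h + \<alpha> * \<beta>) / (1 + \<alpha>\<^sup>2)" using a by simp
    have "\<alpha> * h = \<beta> + s * \<kappa> + \<alpha>\<^sup>2 * s * \<kappa>"
      unfolding \<kappa>(3) distrib_left \<kappa>(2) by (simp add: power2_eq_square)
    then have "\<beta> - \<alpha> * h = - (s * \<kappa> * (1 + \<alpha>\<^sup>2))" by (simp add: algebra_simps)
    then have "(\<beta> - \<alpha> * h)\<^sup>2 = - (s\<^sup>2 * (\<mu> * (1 + \<alpha>\<^sup>2)\<^sup>2))"
      by (simp add: power_mult_distrib \<kappa>(4))
    then show ?R using \<mu> \<Omega> a by simp
  next
    assume R: ?R
    define \<kappa> where "\<kappa> = (\<alpha> * h - \<beta>) / (s * (1 + \<alpha>\<^sup>2))"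
    have sk: "s * \<kappa> = (\<alpha> * h - \<beta>) / (1 + \<alpha>\<^sup>2)" using s by (simp add: \<kappa>_def)
    have "\<kappa>\<^sup>2 = (\<beta> - \<alpha> * h)\<^sup>2 / (s\<^sup>2 * (1 + \<alpha>\<^sup>2)\<^sup>2)"
      by (simp add: \<kappa>_def power_divide power_mult_distrib power2_commute)
    also have "(\<beta> - \<alpha> * h)\<^sup>2 = - (s\<^sup>2 * (\<mu> * (1 + \<alpha>\<^sup>2)\<^sup>2))"
      using R a by (simp add: field_simps)
    also have "\<dots> / (s\<^sup>2 * (1 + \<alpha>\<^sup>2)\<^sup>2) = - \<mu>" using s a by simp
    finally have k2: "\<kappa>\<^sup>2 = - \<mu>" .
    then have "\<kappa> \<noteq> 0" using R by auto
    moreover have "\<alpha> * \<Omega> = \<beta> + s * \<kappa>"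
      unfolding sk R[THEN conjunct2, THEN conjunct1]
      using a by (simp add: field_simps power2_eq_square)
    moreover have "h = \<Omega> + \<alpha> * s * \<kappa>"
    proof -
      have "\<Omega> + \<alpha> * (s * \<kappa>) = (h + \<alpha> * \<beta> + \<alpha> * (\<alpha> * h - \<beta>)) / (1 + \<alpha>\<^sup>2)"
        unfolding sk R[THEN conjunct2, THEN conjunct1] by (simp add: add_divide_distrib)
      also have "h + \<alpha> * \<beta> + \<alpha> * (\<alpha> * h - \<beta>) = h * (1 + \<alpha>\<^sup>2)"
        by (simp add: power2_eq_square algebra_simps)
      finally show ?thesis using a by (simp add: mult.assoc)
    qed
    ultimately show ?L using k2 by blast
  qed
qed

theorem theorem5:
  fixes \<alpha> \<mu> h \<beta> c :: real
  assumes "\<alpha> > 0" and "\<bar>c\<bar> < 1"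
  shows
    "(\<forall>s \<Omega>. s \<noteq> 0 \<longrightarrow>
       ((\<exists>\<theta> p q. homogeneous_coherent_structure \<alpha> \<mu> h \<beta> c s \<Omega> \<theta> p q) \<longleftrightarrow>
         \<mu> < 0 \<and> (c = 0 \<or> \<beta> = 0) \<and>
         \<Omega> = (h + \<alpha> * \<beta>) / (1 + \<alpha>\<^sup>2) \<and>
         s\<^sup>2 = - ((\<beta> - \<alpha> * h)\<^sup>2 / (\<mu> * (1 + \<alpha>\<^sup>2)\<^sup>2)))) \<and>
     (\<forall>s \<Omega> \<theta> p q. s \<noteq> 0 \<longrightarrow> homogeneous_coherent_structure \<alpha> \<mu> h \<beta> c s \<Omega> \<theta> p q \<longrightarrow>
       oscillating_front \<mu> s \<Omega> (sgn (s * (\<alpha> * h - \<beta>))) \<theta> q) \<and>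
     (\<forall>\<Omega>. \<forall>\<sigma>\<in>{-1, 1}.
       (\<exists>\<theta> p q. homogeneous_coherent_structure \<alpha> \<mu> h \<beta> c 0 \<Omega> \<theta> p q \<and>
                oscillating_front \<mu> 0 \<Omega> \<sigma> \<theta> q) \<longleftrightarrow>
         \<mu> < 0 \<and> (c = 0 \<or> \<beta> = 0) \<and> h = \<Omega> \<and> \<Omega> = \<beta> / \<alpha>) \<and>
     (\<forall>\<sigma>\<in>{-1, 1}.
       \<exists>(H :: real \<times> real \<times> real \<times> real \<Rightarrow> real) (W :: real \<times> real \<times> real \<times> real \<Rightarrow> real)
         (\<Theta> :: (real \<times> real \<times> real \<times> real) \<times> real \<Rightarrow> real).
         (let U = {(a, m, b, s). a > 0 \<and> m < 0} in
           smooth_on U H \<and> smooth_on U W \<and> smooth_on (U \<times> UNIV) \<Theta>) \<and>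
         (\<forall>a m b s. a > 0 \<longrightarrow> m < 0 \<longrightarrow>
           (s = 0 \<longrightarrow> H (a, m, b, s) = b / a \<and> W (a, m, b, s) = b / a) \<and>
           (\<forall>k. \<bar>k\<bar> < 1 \<longrightarrow> k = 0 \<or> b = 0 \<longrightarrow>
             (\<forall>g \<omega> \<theta>.
               (\<exists>p q. homogeneous_coherent_structure a m g b k s \<omega> \<theta> p q \<and>
                      oscillating_front m s \<omega> \<sigma> \<theta> q) \<longleftrightarrow>
               g = H (a, m, b, s) \<and> \<omega> = W (a, m, b, s) \<and>
               (\<exists>\<xi>\<^sub>0. \<exists>\<epsilon>\<in>{-1, 1}. \<exists>n :: int. \<forall>\<xi>.
                 \<theta> \<xi> = \<epsilon> * \<Theta> ((a, m, b, s), \<xi> - \<xi>\<^sub>0) + 2 * pi * of_int n)))))"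
proof (intro conjI)
  show "\<forall>s \<Omega>. s \<noteq> 0 \<longrightarrow>
       ((\<exists>\<theta> p q. homogeneous_coherent_structure \<alpha> \<mu> h \<beta> c s \<Omega> \<theta> p q) \<longleftrightarrow>
         \<mu> < 0 \<and> (c = 0 \<or> \<beta> = 0) \<and>
         \<Omega> = (h + \<alpha> * \<beta>) / (1 + \<alpha>\<^sup>2) \<and>
         s\<^sup>2 = - ((\<beta> - \<alpha> * h)\<^sup>2 / (\<mu> * (1 + \<alpha>\<^sup>2)\<^sup>2)))"
  proof (intro allI impI)
    fix s \<Omega> :: real assume s: "s \<noteq> 0"
    let ?param = "\<lambda>\<kappa>. \<alpha> * \<Omega> = \<beta> + s * \<kappa> \<and> h = \<Omega> + \<alpha> * s * \<kappa> \<and> \<kappa>\<^sup>2 = - \<mu>"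
    have "(\<exists>\<theta> p q. homogeneous_coherent_structure \<alpha> \<mu> h \<beta> c s \<Omega> \<theta> p q) \<longleftrightarrow>
      (c = 0 \<or> \<beta> = 0) \<and> (\<exists>\<kappa>. \<kappa> \<noteq> 0 \<and> ?param \<kappa>)" (is "?L \<longleftrightarrow> ?R")
    proof
      assume ?L
      then obtain \<theta> p q where hcs: "homogeneous_coherent_structure \<alpha> \<mu> h \<beta> c s \<Omega> \<theta> p q" by blast
      obtain \<kappa> where "\<kappa> \<noteq> 0" "wall_profile \<kappa> \<theta>"
        using moving_homogeneous_imp_wall_profile[OF assms(2) s hcs] by blast
      then show ?R
        using wall_profile_homogeneous_iff[OF assms(2), THEN iffD1, OF _ _ hcs] by blast
    next
      assume ?R
      then show ?L
        using wall_profile_homogeneous_iff[OF assms(2) _ wall_profile_kink] by blast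
    qed
    then show "(\<exists>\<theta> p q. homogeneous_coherent_structure \<alpha> \<mu> h \<beta> c s \<Omega> \<theta> p q) \<longleftrightarrow>
         \<mu> < 0 \<and> (c = 0 \<or> \<beta> = 0) \<and>
         \<Omega> = (h + \<alpha> * \<beta>) / (1 + \<alpha>\<^sup>2) \<and>
         s\<^sup>2 = - ((\<beta> - \<alpha> * h)\<^sup>2 / (\<mu> * (1 + \<alpha>\<^sup>2)\<^sup>2))"
      unfolding moving_parameters_iff[OF s] by blast
  qed
next
  show "\<forall>s \<Omega> \<theta> p q. s \<noteq> 0 \<longrightarrow> homogeneous_coherent_structure \<alpha> \<mu> h \<beta> c s \<Omega> \<theta> p q \<longrightarrow>
       oscillating_front \<mu> s \<Omega> (sgn (s * (\<alpha> * h - \<beta>))) \<theta> q"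
  proof (intro allI impI)
    fix s \<Omega> \<theta> p q
    assume s: "s \<noteq> 0" and hcs: "homogeneous_coherent_structure \<alpha> \<mu> h \<beta> c s \<Omega> \<theta> p q"
    obtain \<kappa> where \<kappa>: "\<kappa> \<noteq> 0" and prof: "wall_profile \<kappa> \<theta>"
      using moving_homogeneous_imp_wall_profile[OF assms(2) s hcs] by blast
    have e: "\<alpha> * \<Omega> = \<beta> + s * \<kappa>" "h = \<Omega> + \<alpha> * s * \<kappa>" "\<kappa>\<^sup>2 = - \<mu>"
      using wall_profile_homogeneous_iff[OF assms(2) \<kappa> prof, THEN iffD1, OF hcs] by auto
    \<comment> \<open>The sign of \<open>\<kappa>\<close> is read off from \<open>s (\<alpha> h - \<beta>) = s\<^sup>2 (1 + \<alpha>\<^sup>2) \<kappa>\<close>.\<close>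
    have "s * (\<alpha> * h - \<beta>) = s * (\<alpha> * \<Omega> + \<alpha> * (\<alpha> * s * \<kappa>) - \<beta>)"
      unfolding e(2) by (simp add: algebra_simps)
    also have "\<dots> = s\<^sup>2 * (1 + \<alpha>\<^sup>2) * \<kappa>"
      unfolding e(1) by (simp add: power2_eq_square algebra_simps)
    finally have sg: "s * (\<alpha> * h - \<beta>) = s\<^sup>2 * (1 + \<alpha>\<^sup>2) * \<kappa>" .
    have "s\<^sup>2 * (1 + \<alpha>\<^sup>2) > 0" using s by (simp add: add_pos_nonneg)
    then have "sgn (s * (\<alpha> * h - \<beta>)) = sgn \<kappa>"
      unfolding sg sgn_mult[of _ \<kappa>] by simp
    moreover have "sqrt (- \<mu>) = \<bar>\<kappa>\<bar>" by (simp flip: e(3))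
    ultimately have "sgn (s * (\<alpha> * h - \<beta>)) * sqrt (- \<mu>) = \<kappa>"
      by (simp add: sgn_mult_abs)
    with \<kappa> prof show "oscillating_front \<mu> s \<Omega> (sgn (s * (\<alpha> * h - \<beta>))) \<theta> q"
      by (intro wall_profile_oscillating_front) (simp_all only: not_False_eq_True)
  qed
next
  show "\<forall>\<Omega>. \<forall>\<sigma>\<in>{-1, 1}.
       (\<exists>\<theta> p q. homogeneous_coherent_structure \<alpha> \<mu> h \<beta> c 0 \<Omega> \<theta> p q \<and>
                oscillating_front \<mu> 0 \<Omega> \<sigma> \<theta> q) \<longleftrightarrow>
         \<mu> < 0 \<and> (c = 0 \<or> \<beta> = 0) \<and> h = \<Omega> \<and> \<Omega> = \<beta> / \<alpha>"
  proof (intro allI ballI)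
    fix \<Omega> \<sigma> :: real assume \<sigma>: "\<sigma> \<in> {-1, 1}"
    have "\<alpha> * \<Omega> = \<beta> \<longleftrightarrow> \<Omega> = \<beta> / \<alpha>" using assms(1) by (auto simp: field_simps)
    then show "(\<exists>\<theta> p q. homogeneous_coherent_structure \<alpha> \<mu> h \<beta> c 0 \<Omega> \<theta> p q \<and>
                oscillating_front \<mu> 0 \<Omega> \<sigma> \<theta> q) \<longleftrightarrow>
         \<mu> < 0 \<and> (c = 0 \<or> \<beta> = 0) \<and> h = \<Omega> \<and> \<Omega> = \<beta> / \<alpha>"
      unfolding front_homogeneous_iff[OF assms(2) \<sigma>]
      using wall_profile_kink by auto
  qed
next
  show "\<forall>\<sigma>\<in>{-1, 1}.
       \<exists>(H :: real \<times> real \<times> real \<times> real \<Rightarrow> real) (W :: real \<times> real \<times> real \<times> real \<Rightarrow> real)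
         (\<Theta> :: (real \<times> real \<times> real \<times> real) \<times> real \<Rightarrow> real).
         (let U = {(a, m, b, s). a > 0 \<and> m < 0} in
           smooth_on U H \<and> smooth_on U W \<and> smooth_on (U \<times> UNIV) \<Theta>) \<and>
         (\<forall>a m b s. a > 0 \<longrightarrow> m < 0 \<longrightarrow>
           (s = 0 \<longrightarrow> H (a, m, b, s) = b / a \<and> W (a, m, b, s) = b / a) \<and>
           (\<forall>k. \<bar>k\<bar> < 1 \<longrightarrow> k = 0 \<or> b = 0 \<longrightarrow>
             (\<forall>g \<omega> \<theta>.
               (\<exists>p q. homogeneous_coherent_structure a m g b k s \<omega> \<theta> p q \<and>
                      oscillating_front m s \<omega> \<sigma> \<theta> q) \<longleftrightarrow>
               g = H (a, m, b, s) \<and> \<omega> = W (a, m, b, s) \<and>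
               (\<exists>\<xi>\<^sub>0. \<exists>\<epsilon>\<in>{-1, 1}. \<exists>n :: int. \<forall>\<xi>.
                 \<theta> \<xi> = \<epsilon> * \<Theta> ((a, m, b, s), \<xi> - \<xi>\<^sub>0) + 2 * pi * of_int n))))"
  proof
    fix \<sigma> :: real assume \<sigma>: "\<sigma> \<in> {-1, 1}"
    define U :: "(real \<times> real \<times> real \<times> real) set" where "U = {(a, m, b, s). a > 0 \<and> m < 0}"
    \<comment> \<open>Solving the relations of \<open>front_homogeneous_iff\<close> for \<open>\<Omega>\<close> and \<open>h\<close> in terms of \<open>x = (\<alpha>, \<mu>, \<beta>, s)\<close> gives
      \<open>W\<close> and \<open>H\<close>; \<open>K\<close> is the slope \<open>\<kappa>\<close>. They are written with projections and products so that
      the closure properties of smooth functions apply.\<close>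
    define K :: "real \<times> real \<times> real \<times> real \<Rightarrow> real" where
      "K x = \<sigma> * sqrt (- 1 * fst (snd x))" for x
    define W :: "real \<times> real \<times> real \<times> real \<Rightarrow> real" where
      "W x = (fst (snd (snd x)) + snd (snd (snd x)) * K x) * inverse (fst x)" for x
    define H :: "real \<times> real \<times> real \<times> real \<Rightarrow> real" where
      "H x = W x + fst x * snd (snd (snd x)) * K x" for x
    define \<Theta> :: "(real \<times> real \<times> real \<times> real) \<times> real \<Rightarrow> real" where
      "\<Theta> z = kink (K (fst z) * snd z)" for z
    have "U = {x. 0 < fst x} \<inter> {x. fst (snd x) < 0}" by (auto simp: U_def)
    also have "open \<dots>"
      by (intro open_Int open_Collect_less continuous_intros)
    finally have U: "open U" .
    then have UV: "open (U \<times> (UNIV :: real set))" by (intro open_Times open_UNIV)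
    have sqrt: "smooth_on S (\<lambda>x. sqrt (f x))" if "open S" "smooth_on S f" "\<And>x. x \<in> S \<Longrightarrow> f x > 0"
      for S :: "'z::euclidean_space set" and f
      by (rule smooth_on_compose_real[OF that(1) _ _ smooth_on_sqrt that(2)])
        (use that(3) in \<open>auto intro!: open_Collect_less continuous_intros\<close>)
    have inv: "smooth_on U (\<lambda>x. inverse (fst x))"
    proof (rule smooth_on_compose_real[OF U _ _ smooth_on_inverse])
      show "open {y::real. y \<noteq> 0}" by (intro open_Collect_neq continuous_intros)
      show "fst ` U \<subseteq> {y. y \<noteq> 0}" by (auto simp: U_def)
      show "smooth_on U fst" by (intro smooth_on_linear U bounded_linear_fst)
    qed
    have K: "smooth_on U K"
      unfolding K_def[abs_def]
      by (intro smooth_on_mult smooth_on_const sqrt smooth_on_linear bounded_linear_intros U)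
        (auto simp: U_def)
    have K': "smooth_on (U \<times> (UNIV :: real set)) (\<lambda>z. K (fst z))"
      unfolding K_def[abs_def]
      by (intro smooth_on_mult smooth_on_const sqrt smooth_on_linear bounded_linear_intros UV)
        (auto simp: U_def)
    have W: "smooth_on U W"
      unfolding W_def[abs_def]
      by (intro smooth_on_mult smooth_on_add K inv smooth_on_linear bounded_linear_intros U)
    have H: "smooth_on U H"
      unfolding H_def[abs_def]
      by (intro smooth_on_mult smooth_on_add K W smooth_on_linear bounded_linear_intros U)
    have \<Theta>: "smooth_on (U \<times> UNIV) \<Theta>"
      unfolding \<Theta>_def[abs_def]
      by (intro smooth_on_compose_real[OF UV open_UNIV subset_UNIV smooth_on_kink]
          smooth_on_mult K' smooth_on_linear bounded_linear_intros UV)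
    have "(\<exists>p q. homogeneous_coherent_structure a m g b k s \<omega> \<theta> p q \<and>
            oscillating_front m s \<omega> \<sigma> \<theta> q) \<longleftrightarrow>
          g = H (a, m, b, s) \<and> \<omega> = W (a, m, b, s) \<and>
          (\<exists>\<xi>\<^sub>0. \<exists>\<epsilon>\<in>{-1, 1}. \<exists>n :: int. \<forall>\<xi>.
            \<theta> \<xi> = \<epsilon> * \<Theta> ((a, m, b, s), \<xi> - \<xi>\<^sub>0) + 2 * pi * of_int n)"
      if a: "a > 0" and m: "m < 0" and k: "\<bar>k\<bar> < 1" and kb: "k = 0 \<or> b = 0" for a m b s k g \<omega> \<theta>
    proof -
      let ?\<kappa> = "\<sigma> * sqrt (- m)"
      have \<kappa>: "?\<kappa> \<noteq> 0" using \<sigma> m by auto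
      have "a * \<omega> = b + s * ?\<kappa> \<longleftrightarrow> \<omega> = W (a, m, b, s)"
        using a by (auto simp: W_def K_def field_simps)
      moreover have "H (a, m, b, s) = W (a, m, b, s) + a * s * ?\<kappa>"
        by (simp add: H_def K_def)
      moreover have "\<Theta> ((a, m, b, s), \<xi>) = kink (?\<kappa> * \<xi>)" for \<xi>
        by (simp add: \<Theta>_def K_def)
      ultimately show ?thesis
        unfolding front_homogeneous_iff[OF k \<sigma>] wall_profile_iff_kink[OF \<kappa>]
        using m kb by auto
    qed
    moreover have "H (a, m, b, 0) = b / a" "W (a, m, b, 0) = b / a" for a m b
      by (simp_all add: H_def W_def divide_inverse)
    ultimately show "\<exists>(H :: real \<times> real \<times> real \<times> real \<Rightarrow> real) W
         (\<Theta> :: (real \<times> real \<times> real \<times> real) \<times> real \<Rightarrow> real).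
         (let U = {(a, m, b, s). a > 0 \<and> m < 0} in
           smooth_on U H \<and> smooth_on U W \<and> smooth_on (U \<times> UNIV) \<Theta>) \<and>
         (\<forall>a m b s. a > 0 \<longrightarrow> m < 0 \<longrightarrow>
           (s = 0 \<longrightarrow> H (a, m, b, s) = b / a \<and> W (a, m, b, s) = b / a) \<and>
           (\<forall>k. \<bar>k\<bar> < 1 \<longrightarrow> k = 0 \<or> b = 0 \<longrightarrow>
             (\<forall>g \<omega> \<theta>.
               (\<exists>p q. homogeneous_coherent_structure a m g b k s \<omega> \<theta> p q \<and>
                      oscillating_front m s \<omega> \<sigma> \<theta> q) \<longleftrightarrow>
               g = H (a, m, b, s) \<and> \<omega> = W (a, m, b, s) \<and>
               (\<exists>\<xi>\<^sub>0. \<exists>\<epsilon>\<in>{-1, 1}. \<exists>n :: int. \<forall>\<xi>.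
                 \<theta> \<xi> = \<epsilon> * \<Theta> ((a, m, b, s), \<xi> - \<xi>\<^sub>0) + 2 * pi * of_int n))))"
      using H W \<Theta> unfolding U_def
      by (intro exI[of _ H] exI[of _ W] exI[of _ \<Theta>]) (auto simp: Let_def)
  qed
qed

end
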